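(* Let $2\le S'\le S$ be integers and let $k$ be an integer with $0\le k\le S'-2$. Consider two queueing systems of parallel queues under the semi-cyclic service policy SCS($k$), having respectively $S$ and $S'$ servers and fed by the same input $\{(\sigma_n,\tau_n);\,n\in\mathbb N\}$, and let $\{W_n^{k,S}\}_{n\in\mathbb N}$ and $\{W_n^{k,S'}\}_{n\in\mathbb N}$ be their workload profile sequences, i.e. almost surely for all $n\ge 0$, $W_{n+1}^{k,S}=\Phi^{k,S}(W_n^{k,S},\sigma_n,\tau_n)$ and $W_{n+1}^{k,S'}=\Phi^{k,S'}(W_n^{k,S'},\sigma_n,\tau_n)$. Assume that the initial profiles satisfy $W_0^{k,S}\prec_* W_0^{k,S'}$ (almost surely). Then, almost surely, for all $n\ge 0$, $W_n^{k,S}\prec_* W_n^{k,S'}$, that is, $$W_n^{k,S}(S-i)\le W_n^{k,S'}(S'-i),\quad i\in\{0,1,\dots,S'-2\},$$ $$W_n^{k,S}(1)\le W_n^{k,S'}(1).$$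
   Context: Notation: $x\wedge y=\min(x,y)$, $x\vee y=\max(x,y)$, $x^+=\max(x,0)$, $\mathbb R_+=[0,\infty)$. For $u\in(\mathbb R_+)^q$, $u(i)$ is its $i$-th coordinate, and by convention $u(q+1)=\infty$. Ordering: for positive integers $S'\le S$, $u\in(\mathbb R_+)^S$ and $v\in(\mathbb R_+)^{S'}$, write $u\prec_* v$ if $u(S-\ell)\le v(S'-\ell)$ for all integers $\ell$ with $0\le\ell\le S'-2$, and $u(1)\le v(1)$. Input: $(\sigma_n,\tau_n)_{n\in\mathbb N}$ is a stationary (hence identically distributed) sequence of random variables on a probability space, where $\sigma_n\ge0$ is the service time of customer $n$ and $\tau_n$ the inter-arrival time between customers $n$ and $n+1$; $\sigma_0$ and $\tau_0$ are integrable and $\tau_0>0$ a.s. SCS($k$) system with $S$ servers: each server has its own FIFO queue; the servers to which the last $k$ customers were assigned are not available (turn-over servers), and an incoming customer is definitively sent to the server of least workload among the $S-k$ other ones ($k=0$ is Join the Shortest Workload). The workload profile $W_n^{k,S}\in(\mathbb R_+)^S$ is what customer $n$ sees upon arrival: its first $S-k$ coordinates are the workloads of the available servers in nondecreasing order $W_n^{k,S}(1)\le\dots\le W_n^{k,S}(S-k)$, and for $0\le\ell\le k-1$ its coordinate $S-\ell$ is the workload of the turn-over server to which customer $n-(\ell+1)$ was assigned. In particular the initial profile $W_0^{k,S}$ is a (random) vector whose first $S-k$ coordinates are nondecreasing. The profile evolves by the driving map $\Phi^{k,S}$, defined for $u\in(\mathbb R_+)^S$ and $s,t\ge0$ as follows.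 If $k>0$: $\Phi^{k,S}(u,s,t)(1)=[u(2)\wedge u(S-k+1)-t]^+$; $\Phi^{k,S}(u,s,t)(i)=[u(i)\vee(u(i+1)\wedge u(S-k+1))-t]^+$ for $2\le i\le S-k$; $\Phi^{k,S}(u,s,t)(i)=[u(i+1)-t]^+$ for $S-k+1\le i\le S-1$; $\Phi^{k,S}(u,s,t)(S)=[u(1)+s-t]^+$. If $k=0$: $\Phi^{0,S}(u,s,t)(i)=[u(i)\vee((u(1)+s)\wedge u(i+1))-t]^+$ for $1\le i\le S$ (for $u$ nondecreasing this is the nondecreasing rearrangement of $([u(1)+s-t]^+,[u(2)-t]^+,\dots,[u(S)-t]^+)$). The same definitions apply with $S'$ in place of $S$. *)

theory Defs
  imports "HOL-Probability.Probability"
begin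

text \<open>
  A vector of length \<open>q\<close> is a function \<open>nat \<Rightarrow> real\<close> that is \<^const>\<open>undefined\<close> outside the index
  set \<open>{1..q}\<close> (coordinates are counted from 1), so that the points of \<open>{1..q} \<rightarrow>\<^sub>E UNIV\<close>, the
  space of \<open>\<Pi>\<^sub>M i\<in>{1..q}. borel\<close>, correspond one-to-one to the vectors.
\<close>

text \<open>
  The bound \<open>l + 2 \<le> S'\<close> is the integer condition \<open>l \<le> S' - 2\<close>; it is written without
  subtraction so that no \<open>l\<close> qualifies when \<open>S' = 1\<close>.
\<close>

definition prec_star :: "nat \<Rightarrow> nat \<Rightarrow> (nat \<Rightarrow> real) \<Rightarrow> (nat \<Rightarrow> real) \<Rightarrow> bool" where
  "prec_star S S' u v \<longleftrightarrow> (\<forall>l. l + 2 \<le> S' \<longrightarrow> u (S - l) \<le> v (S' - l)) \<and> u 1 \<le> v 1"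

text \<open>
  The convention \<open>u (S + 1) = \<infinity>\<close> matters only for \<open>k = 0\<close> and \<open>i = S\<close>, where it turns the minimum
  \<open>min (u 1 + s) (u (i + 1))\<close> into \<open>u 1 + s\<close>.
\<close>

definition scs_map :: "nat \<Rightarrow> nat \<Rightarrow> (nat \<Rightarrow> real) \<Rightarrow> real \<Rightarrow> real \<Rightarrow> nat \<Rightarrow> real" where
  "scs_map k S u s t = (\<lambda>i\<in>{1..S}.
     if k = 0 then
       max 0 (max (u i) (if i = S then u 1 + s else min (u 1 + s) (u (i + 1))) - t)
     else if i = 1 then
       max 0 (min (u 2) (u (S - k + 1)) - t)
     else if i \<le> S - k then
       max 0 (max (u i) (min (u (i + 1)) (u (S - k + 1))) - t)
     else if i \<le> S - 1 then
       max 0 (u (i + 1) - t)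
     else
       max 0 (u 1 + s - t))"

definition profile_space :: "nat \<Rightarrow> nat \<Rightarrow> (nat \<Rightarrow> real) set" where
  "profile_space k S = {u \<in> {1..S} \<rightarrow>\<^sub>E {0..}. mono_on {1..S - k} u}"

text \<open>
  Membership in \<^const>\<open>profile_space\<close> is required of the initial profile only; later profiles
  are determined by the recursion.
\<close>

definition workload_profiles ::
  "'a measure \<Rightarrow> (nat \<Rightarrow> 'a \<Rightarrow> real) \<Rightarrow> (nat \<Rightarrow> 'a \<Rightarrow> real) \<Rightarrow> nat \<Rightarrow> nat \<Rightarrow>
     (nat \<Rightarrow> 'a \<Rightarrow> nat \<Rightarrow> real) \<Rightarrow> bool" where
  "workload_profiles M \<sigma> \<tau> k S W \<longleftrightarrow>
     (\<forall>n. W n \<in> M \<rightarrow>\<^sub>M (\<Pi>\<^sub>M i\<in>{1..S}. borel)) \<and>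
     (AE \<omega> in M. W 0 \<omega> \<in> profile_space k S) \<and>
     (AE \<omega> in M. \<forall>n. W (Suc n) \<omega> = scs_map k S (W n \<omega>) (\<sigma> n \<omega>) (\<tau> n \<omega>))"

definition stationary_sequence ::
  "'a measure \<Rightarrow> 'b measure \<Rightarrow> (nat \<Rightarrow> 'a \<Rightarrow> 'b) \<Rightarrow> bool" where
  "stationary_sequence M N X \<longleftrightarrow>
     (\<forall>n. X n \<in> M \<rightarrow>\<^sub>M N) \<and>
     (\<forall>m. distr M (\<Pi>\<^sub>M n\<in>UNIV. N) (\<lambda>\<omega> n. X (n + m) \<omega>) =
          distr M (\<Pi>\<^sub>M n\<in>UNIV. N) (\<lambda>\<omega> n. X n \<omega>))"

end

theory Submission
  imports Defs
begin

text \<open>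
  The comparison is pathwise: it is an induction on \<open>n\<close> along almost every trajectory, whose step
  is that one application of the driving maps preserves \<open>\<prec>\<^sub>*\<close> (\<open>prec_star_scs_map\<close>).

  Count coordinates from the top, so that \<open>S - l\<close> in the large system is paired with \<open>S' - l\<close> in
  the small one. Except in coordinate 1, both maps compute the coordinate at distance \<open>l\<close> from the
  top by the same formula, monotone in the coordinates at distance \<open>l\<close>, \<open>l - 1\<close> and \<open>k - 1\<close> from the
  top and in coordinate 1, all of which \<open>\<prec>\<^sub>*\<close> compares. The one exception is coordinate 1, whose
  new value involves coordinate 2, and \<open>\<prec>\<^sub>*\<close> compares \<open>v 2\<close> with \<open>u (S - S' + 2)\<close> rather than with
  \<open>u 2\<close>. Since \<open>k + 2 \<le> S'\<close>, the index
  \<open>S - S' + 2\<close> still belongs to an available server, so \<open>u 2 \<le> u (S - S' + 2)\<close> as long as the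
  available workloads of the large system are sorted; this order is itself preserved by the
  driving map (\<open>mono_on_scs_map\<close>).
\<close>

text \<open>
  Up to the elapsed time \<open>t\<close>, the old and new available workloads interlace: removing the least one
  moves the others down by one position, and inserting the workload of one server (the one that
  becomes available again or, for \<open>k = 0\<close>, the one just joined) moves some of them back up by one.
  The two bounds below are the halves of this interlacing; together they give the order of the new
  available workloads.
\<close>

lemma scs_map_le_shift:
  assumes "mono_on {1..S - k} u" "1 \<le> i" "i < S - k"
  shows "scs_map k S u s t i \<le> max 0 (u (i + 1) - t)"
proof -
  have "u i \<le> u (i + 1)"
    using assms by (intro mono_onD[OF assms(1)]) auto
  then show ?thesis
    using assms by (auto simp: scs_map_def Suc_1[symmetric] simp del: Suc_1)
qed

lemma shift_le_scs_map:
  assumes "2 \<le> i" "i \<le> S - k"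
  shows "max 0 (u i - t) \<le> scs_map k S u s t i"
  using assms by (auto simp: scs_map_def)

lemma mono_on_scs_map:
  assumes "mono_on {1..S - k} u"
  shows "mono_on {1..S - k} (scs_map k S u s t)"
proof (rule mono_onI)
  fix i j
  assume ij: "i \<in> {1..S - k}" "j \<in> {1..S - k}" "i \<le> j"
  show "scs_map k S u s t i \<le> scs_map k S u s t j"
  proof (cases "i = j")
    case False
    with ij have "scs_map k S u s t i \<le> max 0 (u (i + 1) - t)"
      by (intro scs_map_le_shift assms) auto
    also have "u (i + 1) \<le> u j"
      using ij False by (intro mono_onD[OF assms]) auto
    then have "max 0 (u (i + 1) - t) \<le> max 0 (u j - t)"
      by simp
    also have "\<dots> \<le> scs_map k S u s t j"
      using ij False by (intro shift_le_scs_map) auto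
    finally show ?thesis .
  qed simp
qed

text \<open>
  The bound \<open>k + 2 \<le> S'\<close> leaves at least two available servers in the small system, which is what
  puts coordinate \<open>S - S' + 2\<close> among the sorted ones of the large system.
\<close>

lemma prec_star_scs_map:
  assumes mono: "mono_on {1..S - k} u"
    and prec: "prec_star S S' u v"
    and sizes: "k + 2 \<le> S'" "S' \<le> S"
  shows "prec_star S S' (scs_map k S u s t) (scs_map k S' v s t)"
proof -
  have top: "u (S - l) \<le> v (S' - l)" if "l + 2 \<le> S'" for l
    using prec that by (simp add: prec_star_def)
  have first: "u 1 \<le> v 1"
    using prec by (simp add: prec_star_def)
  have "u 2 \<le> u (S - (S' - 2))"
    using sizes by (intro mono_onD[OF mono]) auto
  also have "\<dots> \<le> v (S' - (S' - 2))"
    using sizes by (intro top) auto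
  finally have second: "u 2 \<le> v 2"
    using sizes by (simp add: numeral_2_eq_2)
  \<comment> \<open>The server that becomes available again is at distance \<open>k - 1\<close> from the top.\<close>
  have returning: "u (S - k + 1) \<le> v (S' - k + 1)" if "0 < k"
    using top[of "k - 1"] sizes that by (simp add: Suc_diff_le)
  have "scs_map k S u s t (S - l) \<le> scs_map k S' v s t (S' - l)" if l: "l + 2 \<le> S'" for l
  proof -
    define i j where "i = S - l" and "j = S' - l"
    have here: "u i \<le> v j"
      unfolding i_def j_def using l by (rule top)
    have above: "u (i + 1) \<le> v (j + 1)" if "l \<noteq> 0"
      unfolding i_def j_def using top[of "l - 1"] l sizes that by (simp add: Suc_diff_le)
    \<comment> \<open>All case distinctions in the two maps depend on the distance \<open>l\<close> from the top alone.\<close>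
    have "i \<in> {1..S}" "i \<noteq> 1" "i = S \<longleftrightarrow> l = 0" "i \<le> S - k \<longleftrightarrow> k \<le> l" "i \<le> S - 1 \<longleftrightarrow> l \<noteq> 0"
      unfolding i_def using l sizes by auto
    then have large: "scs_map k S u s t i =
        (if k = 0 then max 0 (max (u i) (if l = 0 then u 1 + s else min (u 1 + s) (u (i + 1))) - t)
         else if k \<le> l then max 0 (max (u i) (min (u (i + 1)) (u (S - k + 1))) - t)
         else if l \<noteq> 0 then max 0 (u (i + 1) - t)
         else max 0 (u 1 + s - t))"
      unfolding scs_map_def by simp
    have "j \<in> {1..S'}" "j \<noteq> 1" "j = S' \<longleftrightarrow> l = 0" "j \<le> S' - k \<longleftrightarrow> k \<le> l" "j \<le> S' - 1 \<longleftrightarrow> l \<noteq> 0"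
      unfolding j_def using l sizes by auto
    then have small: "scs_map k S' v s t j =
        (if k = 0 then max 0 (max (v j) (if l = 0 then v 1 + s else min (v 1 + s) (v (j + 1))) - t)
         else if k \<le> l then max 0 (max (v j) (min (v (j + 1)) (v (S' - k + 1))) - t)
         else if l \<noteq> 0 then max 0 (v (j + 1) - t)
         else max 0 (v 1 + s - t))"
      unfolding scs_map_def by simp
    have "scs_map k S u s t i \<le> scs_map k S' v s t j"
      unfolding large small using here above first returning
      by (cases "k = 0"; cases "l = 0"; cases "k \<le> l")
        (simp_all only: if_True if_False simp_thms le_zero_eq,
         (intro max.mono min.mono diff_right_mono add_right_mono order_refl; simp)+)
    then show ?thesis
      by (simp only: i_def j_def)
  qed
  moreover have "scs_map k S u s t 1 \<le> scs_map k S' v s t 1"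
  proof (cases "k = 0")
    case True
    then have "scs_map k S u s t 1 = max 0 (max (u 1) (min (u 1 + s) (u 2)) - t)"
      "scs_map k S' v s t 1 = max 0 (max (v 1) (min (v 1 + s) (v 2)) - t)"
      using sizes by (simp_all add: scs_map_def numeral_2_eq_2)
    then show ?thesis
      using first second
      by (simp only:) (intro max.mono min.mono diff_right_mono add_right_mono order_refl)
  next
    case False
    then have "scs_map k S u s t 1 = max 0 (min (u 2) (u (S - k + 1)) - t)"
      "scs_map k S' v s t 1 = max 0 (min (v 2) (v (S' - k + 1)) - t)"
      using sizes by (simp_all add: scs_map_def)
    then show ?thesis
      using False second returning
      by (simp only:) (intro max.mono min.mono diff_right_mono order_refl; simp)
  qed
  ultimately show ?thesis
    by (simp add: prec_star_def)
qed

theorem theorem1: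
  fixes M :: "'a measure"
    and \<sigma> \<tau> :: "nat \<Rightarrow> 'a \<Rightarrow> real"
    and W W' :: "nat \<Rightarrow> 'a \<Rightarrow> nat \<Rightarrow> real"
    and S S' k :: nat
  assumes "prob_space M"
    and "stationary_sequence M (borel \<Otimes>\<^sub>M borel) (\<lambda>n \<omega>. (\<sigma> n \<omega>, \<tau> n \<omega>))"
    and "\<And>n. AE \<omega> in M. 0 \<le> \<sigma> n \<omega>"
    and "integrable M (\<sigma> 0)"
    and "integrable M (\<tau> 0)"
    and "AE \<omega> in M. 0 < \<tau> 0 \<omega>"
    and "2 \<le> S'"
    and "S' \<le> S"
    and "k \<le> S' - 2"
    and "workload_profiles M \<sigma> \<tau> k S W"
    and "workload_profiles M \<sigma> \<tau> k S' W'"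
    and "AE \<omega> in M. prec_star S S' (W 0 \<omega>) (W' 0 \<omega>)"
  shows "AE \<omega> in M. \<forall>n. prec_star S S' (W n \<omega>) (W' n \<omega>)"
proof -
  have sizes: "k + 2 \<le> S'" "S' \<le> S"
    using assms(7-9) by auto
  have "AE \<omega> in M. W 0 \<omega> \<in> profile_space k S"
    "AE \<omega> in M. \<forall>n. W (Suc n) \<omega> = scs_map k S (W n \<omega>) (\<sigma> n \<omega>) (\<tau> n \<omega>)"
    "AE \<omega> in M. \<forall>n. W' (Suc n) \<omega> = scs_map k S' (W' n \<omega>) (\<sigma> n \<omega>) (\<tau> n \<omega>)"
    using assms(10,11) by (simp_all add: workload_profiles_def)
  then show ?thesis
    using assms(12)
  proof eventually_elim
    case (elim \<omega>)
    have "mono_on {1..S - k} (W n \<omega>) \<and> prec_star S S' (W n \<omega>) (W' n \<omega>)" for n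
    proof (induction n)
      case 0
      show ?case
        using elim(1,4) by (simp add: profile_space_def)
    next
      case (Suc n)
      then show ?case
        unfolding elim(2)[rule_format] elim(3)[rule_format]
        using sizes by (intro conjI mono_on_scs_map prec_star_scs_map) simp_all
    qed
    then show ?case
      by blast
  qed
qed

end
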